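(* For all $\kappa\ge2$ and all $d\ge4$, there exists an action set $\mathcal A\subset\mathbb R^d\times\{-1,1\}$ such that for any bandit algorithm and for all $(\Delta_{\min},\Delta_{\neq})\in(0,\tfrac18)^2$ with $\Delta_{\min}\le\Delta_{\neq}$, $$\liminf_{T\to\infty}\ \sup_{\theta\in\mathbf\Theta^{\mathcal A}_{\Delta_{\min},\Delta_{\neq},\kappa}}\frac{R_T^\theta}{\log(T)}\ \ge\ \left[\frac{d}{10\Delta_{\min}}\right]\vee\left[\frac{\kappa+2}{8\Delta_{\neq}^2}\right],$$ where $R_T^\theta$ is the regret of the algorithm on the problem with parameter $\theta$.
   Context: **Biased linear bandit.** An action set is a finite set $\mathcal A=\{a_x=\binom{x}{z_x}:x\in\mathcal X\}\subset\mathbb R^d\times\{-1,1\}$, with distinct covariates $x\in\mathcal X\subset\mathbb R^d$ and known sensitive attributes (groups) $z_x\in\{-1,1\}$; both groups are nonempty and $\mathcal A$ spans $\mathbb R^{d+1}$. A problem is characterized by a parameter $\theta=\binom{\gamma}{\omega}$, $\gamma\in\mathbb R^d$, $\omega\in\mathbb R$. At each round $t\le T$ the player (algorithm) chooses $x_t\in\mathcal X$ based on past choices and observations (and possibly independent randomization) and observes $y_t=x_t^\top\gamma+z_{x_t}\omega+\xi_t$ with $\xi_t$ i.i.d. $\mathcal N(0,1)$. The regret is $R_T^\theta=\mathbb E\big[\sum_{t\le T}(x^*-x_t)^\top\gamma\big]$ with $x^*\in\arg\max_{x\in\mathcal X}x^\top\gamma$. **Notation.** $u\vee v=\max(u,v)$.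 $\mathcal C(\mathcal X)=\{\gamma\in\mathbb R^d:|x^\top\gamma|\le1\ \forall x\in\mathcal X\}$. For $\mu:\mathcal X\to[0,\infty)$ let $V(\mu)=\sum_x\mu(x)a_xa_x^\top$; $M^+$ is a generalized inverse of $M$; $e_{d+1}$ is the last canonical basis vector of $\mathbb R^{d+1}$. For $\Delta\in[0,\infty)^{\mathcal X}$, $$\kappa(\Delta)=\inf\Big\{\sum_{x\in\mathcal X}\mu(x)\Delta_x:\ \mu:\mathcal X\to[0,\infty),\ e_{d+1}\in\mathrm{Range}(V(\mu)),\ e_{d+1}^\top V(\mu)^+e_{d+1}\le1\Big\}.$$ For $\gamma\in\mathcal C(\mathcal X)$, $\Delta(\gamma)=(\Delta(\gamma)_x)_{x\in\mathcal X}$ with $\Delta(\gamma)_x=\max_{x'\in\mathcal X}(x'-x)^\top\gamma$. **Parameter classes.** $\mathbf\Theta^{\mathcal A}_{\Delta_{\min},\Delta_{\neq}}$ is the set of $\theta=\binom{\gamma}{\omega}\in\mathbb R^{d+1}$ with $\gamma\in\mathcal C(\mathcal X)$ such that the maximizer $x^*$ of $x^\top\gamma$ over $x\in\mathcal X$ is unique, $(x^*-x')^\top\gamma\ge\Delta_{\min}$ for all $x'\in\mathcal X$ with $x'\ne x^*$, and $(x^*-x')^\top\gamma\ge\Delta_{\neq}$ for all $x'\in\mathcal X$ with $z_{x'}\ne z_{x^*}$. Finally $\mathbf\Theta^{\mathcal A}_{\Delta_{\min},\Delta_{\neq},\kappa}=\mathbf\Theta^{\mathcal A}_{\Delta_{\min},\Delta_{\neq}}\cap\{\binom{\gamma}{\omega}:\gamma\in\mathcal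 C(\mathcal X),\ \kappa(\Delta(\gamma))\le\kappa\}$. *)

theory Defs
  imports "HOL-Probability.Probability"
begin

section \<open>Action sets\<close>

text \<open>
  Coordinates of \<open>\<real>\<^sup>d\<close> are indexed by \<^typ>\<open>'n\<close>, those of \<open>\<real>\<^sup>d\<^sup>+\<^sup>1\<close> by \<^typ>\<open>'n option\<close>, where
  \<^term>\<open>None\<close> is the last coordinate. An action set is given by its covariates \<open>X\<close> and its
  group labels \<open>z\<close>; only the values of \<open>z\<close> on \<open>X\<close> matter.
\<close>

definition action :: "(real ^ 'n \<Rightarrow> real) \<Rightarrow> real ^ 'n \<Rightarrow> real ^ ('n option)" where
  "action z x = (\<chi> i. case i of None \<Rightarrow> z x | Some j \<Rightarrow> x $ j)"

definition action_set :: "(real ^ 'n) set \<Rightarrow> (real ^ 'n \<Rightarrow> real) \<Rightarrow> bool" where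
  "action_set X z \<longleftrightarrow>
     finite X \<and> (\<forall>x\<in>X. z x \<in> {-1, 1}) \<and>
     (\<exists>x\<in>X. z x = 1) \<and> (\<exists>x\<in>X. z x = -1) \<and>
     span (action z ` X) = UNIV"


section \<open>Generalized inverses and the bias estimation cost\<close>

definition is_gen_inverse :: "real ^ 'n ^ 'm \<Rightarrow> real ^ 'm ^ 'n \<Rightarrow> bool" where
  "is_gen_inverse M G \<longleftrightarrow> M ** G ** M = M"

definition gen_inverse :: "real ^ 'n ^ 'm \<Rightarrow> real ^ 'm ^ 'n" where
  "gen_inverse M = (SOME G. is_gen_inverse M G)"

lemma is_gen_inverse_gen_inverse: "is_gen_inverse M (gen_inverse M)"
proof -
  have "\<exists>g. range g \<subseteq> UNIV \<and> linear g \<and> (\<forall>v\<in>range ((*v) M). M *v g v = v)"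
    using linear_exists_right_inverse_on[OF matrix_vector_mul_linear[of M] subspace_UNIV] by auto
  then obtain g where g: "linear g" "\<And>v. M *v g (M *v v) = M *v v"
    by blast
  have "(M ** matrix g ** M) *v v = M *v v" for v
    using g by (simp add: matrix_vector_mul_assoc [symmetric] matrix_works)
  then have "is_gen_inverse M (matrix g)"
    unfolding is_gen_inverse_def by (simp add: matrix_eq)
  then show ?thesis
    unfolding gen_inverse_def by (rule someI)
qed

text \<open>The choice of generalized inverse is immaterial for the quadratic form used below.\<close>

lemma gen_inverse_quadratic_form_unique:
  assumes "transpose M = M" "v \<in> range ((*v) M)" "is_gen_inverse M G" "is_gen_inverse M H"
  shows "v \<bullet> (G *v v) = v \<bullet> (H *v v)"
proof -
  obtain u where u: "v = M *v u"
    using assms(2) by blast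
  have "v \<bullet> (K *v v) = u \<bullet> (M *v u)" if "is_gen_inverse M K" for K
  proof -
    have "v \<bullet> (K *v v) = u \<bullet> (M *v (K *v (M *v u)))"
      using assms(1) u by (metis dot_lmul_matrix vector_transpose_matrix)
    also have "\<dots> = u \<bullet> (M *v u)"
      using that by (simp add: is_gen_inverse_def matrix_vector_mul_assoc matrix_mul_assoc)
    finally show ?thesis .
  qed
  then show ?thesis
    using assms(3,4) by simp
qed

definition design_matrix ::
  "(real ^ 'n) set \<Rightarrow> (real ^ 'n \<Rightarrow> real) \<Rightarrow> (real ^ 'n \<Rightarrow> real) \<Rightarrow> real ^ ('n option) ^ ('n option)"
where
  "design_matrix X z \<mu> = (\<Sum>x\<in>X. \<mu> x *\<^sub>R (\<chi> i j. action z x $ i * action z x $ j))"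

abbreviation e_last :: "real ^ ('n::finite option)" where
  "e_last \<equiv> axis None 1"

text \<open>
  For an action set and nonnegative \<open>\<Delta>\<close>, the set below is nonempty and bounded below by 0, so that
  the infimum over the reals is meaningful.
\<close>

definition kappa ::
  "(real ^ 'n) set \<Rightarrow> (real ^ 'n \<Rightarrow> real) \<Rightarrow> (real ^ 'n \<Rightarrow> real) \<Rightarrow> real"
where
  "kappa X z \<Delta> =
     Inf {(\<Sum>x\<in>X. \<mu> x * \<Delta> x) | \<mu>.
            (\<forall>x\<in>X. 0 \<le> \<mu> x) \<and>
            e_last \<in> range ((*v) (design_matrix X z \<mu>)) \<and>
            e_last \<bullet> (gen_inverse (design_matrix X z \<mu>) *v e_last) \<le> 1}"


section \<open>Parameter classes\<close>

definition bounded_params :: "(real ^ 'n) set \<Rightarrow> (real ^ 'n) set" where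
  "bounded_params X = {\<gamma>. \<forall>x\<in>X. \<bar>x \<bullet> \<gamma>\<bar> \<le> 1}"

definition gap :: "(real ^ 'n) set \<Rightarrow> real ^ 'n \<Rightarrow> real ^ 'n \<Rightarrow> real" where
  "gap X \<gamma> x = (MAX x'\<in>X. (x' - x) \<bullet> \<gamma>)"

text \<open>A parameter \<open>\<theta>\<close> is the pair \<open>(\<gamma>, \<omega>)\<close>.\<close>

definition gap_class ::
  "(real ^ 'n) set \<Rightarrow> (real ^ 'n \<Rightarrow> real) \<Rightarrow> real \<Rightarrow> real \<Rightarrow> ((real ^ 'n) \<times> real) set"
where
  "gap_class X z \<Delta>min \<Delta>neq =
     {(\<gamma>, \<omega>). \<gamma> \<in> bounded_params X \<and>
        (\<exists>xs. {x. is_arg_max (\<lambda>x. x \<bullet> \<gamma>) (\<lambda>x. x \<in> X) x} = {xs} \<and>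
           (\<forall>x'\<in>X. x' \<noteq> xs \<longrightarrow> (xs - x') \<bullet> \<gamma> \<ge> \<Delta>min) \<and>
           (\<forall>x'\<in>X. z x' \<noteq> z xs \<longrightarrow> (xs - x') \<bullet> \<gamma> \<ge> \<Delta>neq))}"

definition gap_kappa_class ::
  "(real ^ 'n) set \<Rightarrow> (real ^ 'n \<Rightarrow> real) \<Rightarrow> real \<Rightarrow> real \<Rightarrow> real \<Rightarrow> ((real ^ 'n) \<times> real) set"
where
  "gap_kappa_class X z \<Delta>min \<Delta>neq \<kappa> =
     gap_class X z \<Delta>min \<Delta>neq \<inter> {(\<gamma>, \<omega>). \<gamma> \<in> bounded_params X \<and> kappa X z (gap X \<gamma>) \<le> \<kappa>}"


section \<open>Bandit algorithms and regret\<close>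

text \<open>
  Rounds are numbered from 0. The history before round \<open>t\<close> is the family of the pairs
  (choice, observation) of the rounds in \<open>{..<t}\<close>.
\<close>

type_synonym 'n history = "nat \<Rightarrow> (real ^ 'n) \<times> real"

definition history_space :: "(real ^ 'n) set \<Rightarrow> nat \<Rightarrow> 'n history measure" where
  "history_space X t = (\<Pi>\<^sub>M s\<in>{..<t}. count_space X \<Otimes>\<^sub>M borel)"

text \<open>
  \<open>Q\<close> is the law of the internal randomization of the algorithm, and \<open>\<phi> t u h\<close> is the covariate
  chosen in round \<open>t\<close> on seed \<open>u\<close> and history \<open>h\<close>. A single real seed with an arbitrary law
  can encode a whole sequence of independent random variables, so fresh randomization in every
  round is covered.
\<close>

definition bandit_algorithm ::
  "(real ^ 'n) set \<Rightarrow> real measure \<Rightarrow> (nat \<Rightarrow> real \<Rightarrow> 'n history \<Rightarrow> real ^ 'n) \<Rightarrow> bool"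
where
  "bandit_algorithm X Q \<phi> \<longleftrightarrow>
     prob_space Q \<and>
     (\<forall>t. (\<lambda>(u, h). \<phi> t u h) \<in> Q \<Otimes>\<^sub>M history_space X t \<rightarrow>\<^sub>M count_space X)"

text \<open>The interaction with the environment \<open>\<theta>\<close> on seed \<open>u\<close> and noise sequence \<open>\<xi>\<close>.\<close>

primrec history ::
  "(real ^ 'n \<Rightarrow> real) \<Rightarrow> (nat \<Rightarrow> real \<Rightarrow> 'n history \<Rightarrow> real ^ 'n) \<Rightarrow> (real ^ 'n) \<times> real \<Rightarrow>
   real \<Rightarrow> (nat \<Rightarrow> real) \<Rightarrow> nat \<Rightarrow> 'n history"
where
  "history z \<phi> \<theta> u \<xi> 0 = (\<lambda>_. undefined)"
| "history z \<phi> \<theta> u \<xi> (Suc t) =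
     (let h = history z \<phi> \<theta> u \<xi> t; x = \<phi> t u h
      in h(t := (x, x \<bullet> fst \<theta> + z x * snd \<theta> + \<xi> t)))"

definition choice ::
  "(real ^ 'n \<Rightarrow> real) \<Rightarrow> (nat \<Rightarrow> real \<Rightarrow> 'n history \<Rightarrow> real ^ 'n) \<Rightarrow> (real ^ 'n) \<times> real \<Rightarrow>
   real \<Rightarrow> (nat \<Rightarrow> real) \<Rightarrow> nat \<Rightarrow> real ^ 'n"
where
  "choice z \<phi> \<theta> u \<xi> t = \<phi> t u (history z \<phi> \<theta> u \<xi> t)"

definition noise :: "(nat \<Rightarrow> real) measure" where
  "noise = (\<Pi>\<^sub>M t\<in>UNIV. density lborel std_normal_density)"

definition regret ::
  "(real ^ 'n) set \<Rightarrow> (real ^ 'n \<Rightarrow> real) \<Rightarrow> real measure \<Rightarrow>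
   (nat \<Rightarrow> real \<Rightarrow> 'n history \<Rightarrow> real ^ 'n) \<Rightarrow> (real ^ 'n) \<times> real \<Rightarrow> nat \<Rightarrow> real"
where
  "regret X z Q \<phi> \<theta> T =
     (\<integral>(u, \<xi>). (\<Sum>t<T. (arg_max_on (\<lambda>x. x \<bullet> fst \<theta>) X - choice z \<phi> \<theta> u \<xi> t) \<bullet> fst \<theta>)
        \<partial>(Q \<Otimes>\<^sub>M noise))"

end

theory Submission
  imports Defs "HOL-Real_Asymp.Real_Asymp"
begin

text \<open>
  An algorithm with regret of order \<open>log T\<close> on two parameters with different best actions plays one
  action almost always under the first parameter and almost never under the second. Its observations
  must therefore tell the two parameters apart at confidence close to \<open>1 - 1/T\<close>, which costs about
  \<open>log T\<close> of relative entropy. As rewards are Gaussian, the relative entropy of the first \<open>T\<close> rounds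
  is half the sum over actions of the expected number of plays times the squared change of the mean
  reward (\<open>small_regret_forces_exploration\<close>). Whatever action carries this information must be
  played often under the first parameter, and each play of it costs its gap.

  The action set consists of the basis vectors \<open>e\<^sub>1, \<dots>, e\<^sub>d\<close>, of which only \<open>e\<^sub>2\<close> belongs to
  group -1, and one further action \<open>- c e\<^sub>1\<close> in group -1, the probe, where \<open>2 / (1 - c)\<^sup>2 = \<kappa>\<close>. Here
  \<open>e\<^sub>1\<close> and \<open>e\<^sub>2\<close> stand for two arbitrary distinct basis vectors. The probe and \<open>e\<^sub>1\<close> have opposite
  groups and parallel covariates, so that together they determine the bias \<open>\<omega>\<close>. This estimator
  bounds \<open>\<kappa>(\<Delta>(\<gamma>))\<close> by \<open>\<kappa>\<close> for all parameters considered (\<open>in_gap_kappa_class\<close>). Two families of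
  parameter pairs give the two terms of the bound.

  \<^item> Let \<open>e\<^sub>1\<close> be best and let the other actions \<open>e\<^sub>k\<close> of its group have gap \<open>\<Delta>min\<close>. Raising the value of
    one \<open>e\<^sub>k\<close> by \<open>2 \<Delta>min\<close> makes it best and changes no other mean reward. So each of these \<open>d - 2\<close>
    actions has to be played about \<open>log T / \<Delta>min\<^sup>2\<close> times, at cost \<open>\<Delta>min\<close> per play
    (\<open>same_group_lower_bound\<close>).

  \<^item> Let \<open>e\<^sub>1\<close> be better than all other basis vectors by \<open>\<Delta>neq\<close>. Move \<open>\<Delta>neq\<close> from the value of every
    group 1 vector into the bias, and the opposite amount to \<open>e\<^sub>2\<close>. Now \<open>e\<^sub>2\<close> is best, but all basis
    vectors keep their mean rewards: the groups can be compared through the probe only, whose mean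
    changes by \<open>(1 - c) \<Delta>neq\<close> and whose gap is of order 1. This costs
    about \<open>log T / ((1 - c)\<^sup>2 \<Delta>neq\<^sup>2)\<close>, that is, \<open>\<kappa> log T / \<Delta>neq\<^sup>2\<close> up to a constant
    (\<open>bias_estimation_lower_bound\<close>).
\<close>

section \<open>Shifted Gaussian laws\<close>

abbreviation std_normal :: "real measure" where
  "std_normal \<equiv> density lborel std_normal_density"

lemma prob_space_std_normal: "prob_space std_normal"
  by (rule prob_space_normal_density) simp

text \<open>
  The density of \<open>N(\<delta>, 1)\<close> with respect to \<open>N(0, 1)\<close> at \<open>y\<close> is \<open>exp (\<delta> y - \<delta>\<^sup>2 / 2)\<close>.
\<close>

lemma integral_std_normal_shift:
  fixes f :: "real \<Rightarrow> real"
  assumes [measurable]: "f \<in> borel_measurable borel" and bound: "\<And>y. \<bar>f y\<bar> \<le> B"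
  shows "(\<integral>y. f (y + \<delta>) \<partial>std_normal) = (\<integral>y. exp (\<delta> * y - \<delta>\<^sup>2 / 2) * f y \<partial>std_normal)"
    and "integrable std_normal (\<lambda>y. exp (\<delta> * y - \<delta>\<^sup>2 / 2) * f y)"
proof -
  interpret N: prob_space std_normal
    by (rule prob_space_std_normal)
  have density_shift: "std_normal_density (y - \<delta>) = std_normal_density y * exp (\<delta> * y - \<delta>\<^sup>2 / 2)" for y
    unfolding std_normal_density_def mult.assoc exp_add [symmetric]
    by (simp add: power2_eq_square field_simps)
  have int: "integrable std_normal (\<lambda>y. f (y + \<delta>))"
    using bound by (intro N.integrable_const_bound[where B=B]) auto
  then have int': "integrable lborel (\<lambda>y. std_normal_density y * f (y + \<delta>))"
    by (subst (asm) integrable_density) auto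
  have "integrable lborel (\<lambda>y. std_normal_density (y - \<delta>) * f y)"
    using lborel_integrable_real_affine[OF int', of 1 "- \<delta>"] by simp
  then have "integrable lborel (\<lambda>y. std_normal_density y * (exp (\<delta> * y - \<delta>\<^sup>2 / 2) * f y))"
    by (simp add: density_shift mult.assoc)
  then show "integrable std_normal (\<lambda>y. exp (\<delta> * y - \<delta>\<^sup>2 / 2) * f y)"
    by (subst integrable_density) auto
  have "(\<integral>y. f (y + \<delta>) \<partial>std_normal) = (\<integral>y. std_normal_density y * f (y + \<delta>) \<partial>lborel)"
    by (subst integral_density) auto
  also have "\<dots> = (\<integral>y. std_normal_density (y - \<delta>) * f y \<partial>lborel)"
    by (subst lborel_integral_real_affine[where c=1 and t="- \<delta>"]) auto
  also have "\<dots> = (\<integral>y. std_normal_density y * (exp (\<delta> * y - \<delta>\<^sup>2 / 2) * f y) \<partial>lborel)"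
    by (simp add: density_shift mult.assoc)
  also have "\<dots> = (\<integral>y. exp (\<delta> * y - \<delta>\<^sup>2 / 2) * f y \<partial>std_normal)"
    by (subst integral_density) auto
  finally show "(\<integral>y. f (y + \<delta>) \<partial>std_normal) = (\<integral>y. exp (\<delta> * y - \<delta>\<^sup>2 / 2) * f y \<partial>std_normal)" .
qed

lemma std_normal_mean: "integrable std_normal (\<lambda>y. y)" "(\<integral>y. y \<partial>std_normal) = 0"
proof -
  show "integrable std_normal (\<lambda>y. y)"
    using integrable_normal_moment_nz_1[of 1 0] by (subst integrable_density) auto
  show "(\<integral>y. y \<partial>std_normal) = 0"
    using normal_moment_nz_1[of 1 0] 
    by (subst integral_density) (auto simp: has_bochner_integral_iff)
qed

text \<open>
  This is one half of the Donsker-Varadhan formula for the laws \<open>N(m', 1)\<close> and \<open>N(m, 1)\<close>, whose relative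
  entropy is \<open>(m' - m)\<^sup>2 / 2\<close>: writing the right-hand integral against \<open>N(m, 1)\<close> adds the log
  density to the exponent, and Jensen's inequality moves the exponential out of the integral.
\<close>

lemma gaussian_shift_variational:
  fixes f :: "real \<Rightarrow> real"
  assumes [measurable]: "f \<in> borel_measurable borel" and bound: "\<And>y. \<bar>f y\<bar> \<le> B"
  shows "(\<integral>y. f (m + y) \<partial>std_normal) - (m' - m)\<^sup>2 / 2
    \<le> ln (\<integral>y. exp (f (m' + y)) \<partial>std_normal)"
proof -
  interpret N: prob_space std_normal
    by (rule prob_space_std_normal)
  define \<delta> where "\<delta> = m' - m"
  define s where "s y = f (m + y) + (\<delta> * y - \<delta>\<^sup>2 / 2)" for y
  define k where "k = (\<integral>y. f (m + y) \<partial>std_normal) - \<delta>\<^sup>2 / 2"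
  have int_f: "integrable std_normal (\<lambda>y. f (m + y))"
    using bound by (intro N.integrable_const_bound[where B=B]) auto
  have int_s: "integrable std_normal s"
    unfolding s_def using int_f std_normal_mean(1) by (intro Bochner_Integration.integrable_add Bochner_Integration.integrable_diff) auto
  have s_mean: "(\<integral>y. s y \<partial>std_normal) = k"
    unfolding s_def k_def using int_f std_normal_mean N.prob_space
    by (subst Bochner_Integration.integral_add) auto
  have exp_bound: "\<bar>exp (f (m + y))\<bar> \<le> exp B" for y
    using bound[of "m + y"] by simp
  have meas: "(\<lambda>y. exp (f (m + y))) \<in> borel_measurable borel"
    by simp
  have "(\<integral>y. exp (f (m' + y)) \<partial>std_normal) = (\<integral>y. exp (f (m + (y + \<delta>))) \<partial>std_normal)"
    by (simp add: \<delta>_def algebra_simps)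
  also have "\<dots> = (\<integral>y. exp (s y) \<partial>std_normal)"
    unfolding integral_std_normal_shift(1)[OF meas exp_bound] s_def exp_add by (simp add: mult.commute)
  \<comment> \<open>Jensen's inequality, through the tangent of \<open>exp\<close> at the mean \<open>k\<close> of \<open>s\<close>\<close>
  also have "\<dots> \<ge> (\<integral>y. exp k * (1 + (s y - k)) \<partial>std_normal)"
  proof (rule integral_mono)
    show "integrable std_normal (\<lambda>y. exp k * (1 + (s y - k)))"
      using int_s by simp
    show "integrable std_normal (\<lambda>y. exp (s y))"
      using integral_std_normal_shift(2)[OF meas exp_bound, of \<delta>]
      unfolding s_def exp_add by (simp add: mult.commute)
    show "exp k * (1 + (s y - k)) \<le> exp (s y)" for y
      using mult_left_mono[OF exp_ge_add_one_self[of "s y - k"], of "exp k"]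
      by (simp add: exp_add [symmetric])
  qed
  also have "(\<integral>y. exp k * (1 + (s y - k)) \<partial>std_normal) = exp k"
    using int_s s_mean N.prob_space by simp
  finally have "exp k \<le> (\<integral>y. exp (f (m' + y)) \<partial>std_normal)" .
  then have "k \<le> ln (\<integral>y. exp (f (m' + y)) \<partial>std_normal)"
    by (meson exp_gt_zero ln_ge_iff order_less_le_trans)
  then show ?thesis
    by (simp add: k_def \<delta>_def)
qed

section \<open>Runs of an algorithm\<close>

text \<open>
  Replacing one coordinate of the noise by a fresh copy preserves its law. This isolates the noise of round
  \<open>t\<close>, as the history before round \<open>t\<close> is unaffected by the replacement.
\<close>

lemma noise_resample:
  "distr (std_normal \<Otimes>\<^sub>M noise) noise (\<lambda>(y, \<xi>). \<xi>(t := y)) = noise"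
  using distr_pair_PiM_eq_PiM[of UNIV "\<lambda>_. std_normal" t] prob_space_std_normal
  by (simp add: noise_def)

lemma prob_space_noise: "prob_space noise"
  unfolding noise_def by (intro prob_space_PiM prob_space_std_normal)

lemma measurable_noise_component [measurable]: "(\<lambda>\<xi>. \<xi> t) \<in> noise \<rightarrow>\<^sub>M borel"
proof -
  have "(\<lambda>\<xi>. \<xi> t) \<in> noise \<rightarrow>\<^sub>M std_normal"
    unfolding noise_def by measurable
  then show ?thesis by (simp cong: measurable_cong_sets)
qed

locale bandit =
  fixes X :: "(real ^ 'n) set" and z :: "real ^ 'n \<Rightarrow> real"
    and Q :: "real measure" and \<phi> :: "nat \<Rightarrow> real \<Rightarrow> 'n history \<Rightarrow> real ^ 'n"
  assumes finite_X: "finite X" and algorithm: "bandit_algorithm X Q \<phi>"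
begin

sublocale seed: prob_space Q
  using algorithm by (simp add: bandit_algorithm_def)

sublocale noise: prob_space noise
  by (rule prob_space_noise)

sublocale normal: prob_space std_normal
  by (rule prob_space_std_normal)

sublocale run: pair_prob_space Q noise ..

abbreviation run :: "(real \<times> (nat \<Rightarrow> real)) measure" where
  "run \<equiv> Q \<Otimes>\<^sub>M noise"

lemma measurable_\<phi> [measurable]:
  "(\<lambda>p. \<phi> t (fst p) (snd p)) \<in> Q \<Otimes>\<^sub>M history_space X t \<rightarrow>\<^sub>M count_space X"
  using algorithm by (simp add: bandit_algorithm_def case_prod_beta')

definition mean_reward :: "(real ^ 'n) \<times> real \<Rightarrow> real ^ 'n \<Rightarrow> real" where
  "mean_reward \<theta> x = x \<bullet> fst \<theta> + z x * snd \<theta>"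

definition extend :: "(real ^ 'n) \<times> real \<Rightarrow> nat \<Rightarrow> real \<Rightarrow> 'n history \<Rightarrow> real \<Rightarrow> 'n history" where
  "extend \<theta> t u h y = h(t := (\<phi> t u h, mean_reward \<theta> (\<phi> t u h) + y))"

lemma measurable_extend:
  "(\<lambda>((u, h), y). (u, extend \<theta> t u h y)) \<in>
    (Q \<Otimes>\<^sub>M history_space X t) \<Otimes>\<^sub>M std_normal \<rightarrow>\<^sub>M Q \<Otimes>\<^sub>M history_space X (Suc t)"
proof -
  let ?P = "(Q \<Otimes>\<^sub>M history_space X t) \<Otimes>\<^sub>M std_normal"
  have choice: "(\<lambda>p. \<phi> t (fst (fst p)) (snd (fst p))) \<in> ?P \<rightarrow>\<^sub>M count_space X"
    using measurable_compose[OF measurable_fst measurable_\<phi>, of _ std_normal] by simp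
  have reward: "(\<lambda>p. mean_reward \<theta> (\<phi> t (fst (fst p)) (snd (fst p))) + snd p) \<in> ?P \<rightarrow>\<^sub>M borel"
    using measurable_compose[OF choice, of "mean_reward \<theta>" borel]
      measurable_compose[OF measurable_snd, of "\<lambda>y. y" std_normal borel]
    by (intro borel_measurable_add) auto
  have "(\<lambda>p. extend \<theta> t (fst (fst p)) (snd (fst p)) (snd p)) \<in> ?P \<rightarrow>\<^sub>M history_space X (Suc t)"
    unfolding extend_def history_space_def
    using choice reward
    by (intro measurable_fun_upd[where J="{..<t}"] measurable_Pair) (auto simp: history_space_def)
  then show ?thesis
    by (simp add: case_prod_beta')
qed

lemma history_Suc: "history z \<phi> \<theta> u \<xi> (Suc t) = extend \<theta> t u (history z \<phi> \<theta> u \<xi> t) (\<xi> t)"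
  by (simp add: extend_def mean_reward_def Let_def)

lemma history_prefix: "history z \<phi> \<theta> u (\<xi>(t := y)) s = history z \<phi> \<theta> u \<xi> s" if "s \<le> t"
  using that by (induction s) (auto simp: history_Suc simp del: history.simps(2))

lemma history_entry: "fst (history z \<phi> \<theta> u \<xi> t s) = choice z \<phi> \<theta> u \<xi> s" if "s < t"
  using that by (induction t) (auto simp: history_Suc extend_def choice_def less_Suc_eq simp del: history.simps(2))

lemma measurable_history [measurable]:
  "(\<lambda>p. (fst p, history z \<phi> \<theta> (fst p) (snd p) t)) \<in> run \<rightarrow>\<^sub>M Q \<Otimes>\<^sub>M history_space X t"
proof (induction t)
  case 0
  then show ?case
    by (auto simp: history_space_def space_PiM intro!: measurable_Pair measurable_const)
next
  case (Suc t)
  have "(\<lambda>p. ((fst p, history z \<phi> \<theta> (fst p) (snd p) t), snd p t)) \<in>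
      run \<rightarrow>\<^sub>M (Q \<Otimes>\<^sub>M history_space X t) \<Otimes>\<^sub>M std_normal"
    using Suc measurable_compose[OF measurable_snd measurable_noise_component]
    by (intro measurable_Pair) (auto cong: measurable_cong_sets)
  from measurable_compose[OF this measurable_extend[of \<theta>]] show ?case
    by (simp add: history_Suc del: history.simps(2))
qed

lemma measurable_choice [measurable]:
  "(\<lambda>p. choice z \<phi> \<theta> (fst p) (snd p) t) \<in> run \<rightarrow>\<^sub>M count_space X"
  unfolding choice_def using measurable_compose[OF measurable_history measurable_\<phi>] by simp

lemma choice_in_X: "choice z \<phi> \<theta> (fst p) (snd p) t \<in> X" if "p \<in> space run"
  using measurable_space[OF measurable_choice that] by simp

text \<open>
  The transition operator of the chain of histories: \<open>one_step \<theta> t F\<close> is the conditional expectation of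
  \<open>F\<close> after round \<open>t\<close>, given the seed and the history before it.
\<close>

definition one_step :: "(real ^ 'n) \<times> real \<Rightarrow> nat \<Rightarrow> (real \<times> 'n history \<Rightarrow> real) \<Rightarrow> real \<times> 'n history \<Rightarrow> real" where
  "one_step \<theta> t F = (\<lambda>(u, h). \<integral>y. F (u, extend \<theta> t u h y) \<partial>std_normal)"

lemma measurable_one_step:
  assumes "F \<in> borel_measurable (Q \<Otimes>\<^sub>M history_space X (Suc t))"
  shows "one_step \<theta> t F \<in> borel_measurable (Q \<Otimes>\<^sub>M history_space X t)"
  unfolding one_step_def case_prod_beta'
  using measurable_compose[OF measurable_extend assms]
  by (intro normal.borel_measurable_lebesgue_integral) (simp add: case_prod_beta')

lemma one_step_bounded:
  assumes bound: "\<And>p. \<bar>F p\<bar> \<le> B"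
  shows "\<bar>one_step \<theta> t F p\<bar> \<le> B"
proof (cases p)
  case (Pair u h)
  have "\<bar>\<integral>y. F (u, extend \<theta> t u h y) \<partial>std_normal\<bar> \<le> (\<integral>y. B \<partial>std_normal)"
    using bound order_trans[OF abs_ge_zero bound]
    by (intro integral_abs_bound[THEN order_trans] integral_mono') auto
  then show ?thesis
    using normal.prob_space by (simp add: Pair one_step_def)
qed

lemma measurable_extend_section:
  assumes F: "F \<in> borel_measurable (Q \<Otimes>\<^sub>M history_space X (Suc t))" 
    and p: "(u, h) \<in> space (Q \<Otimes>\<^sub>M history_space X t)"
  shows "(\<lambda>y. F (u, extend \<theta> t u h y)) \<in> borel_measurable borel"
proof -
  have "(\<lambda>y. ((u, h), y)) \<in> borel \<rightarrow>\<^sub>M (Q \<Otimes>\<^sub>M history_space X t) \<Otimes>\<^sub>M std_normal"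
    using p by (intro measurable_Pair) (auto simp: space_pair_measure)
  from measurable_compose[OF this measurable_compose[OF measurable_extend F]] show ?thesis
    by simp
qed

text \<open>
  The tower property for the conditional expectation given the history before round \<open>t\<close>.
\<close>

lemma integral_history_Suc:
  assumes F: "F \<in> borel_measurable (Q \<Otimes>\<^sub>M history_space X (Suc t))" and bound: "\<And>p. \<bar>F p\<bar> \<le> B"
  shows "(\<integral>p. F (fst p, history z \<phi> \<theta> (fst p) (snd p) (Suc t)) \<partial>run) =
    (\<integral>p. one_step \<theta> t F (fst p, history z \<phi> \<theta> (fst p) (snd p) t) \<partial>run)"
proof -
  let ?G = "\<lambda>u \<xi>. F (u, history z \<phi> \<theta> u \<xi> (Suc t))"
  have G [measurable]: "(\<lambda>p. ?G (fst p) (snd p)) \<in> borel_measurable run"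
    using measurable_compose[OF measurable_history F] by simp
  have int: "integrable run (\<lambda>(u, \<xi>). ?G u \<xi>)"
    using bound G by (intro run.P.integrable_const_bound[where B=B]) (auto simp: case_prod_beta')
  have int': "integrable run (\<lambda>(u, \<xi>). one_step \<theta> t F (u, history z \<phi> \<theta> u \<xi> t))"
    using one_step_bounded[OF bound] measurable_compose[OF measurable_history measurable_one_step[OF F]]
    by (intro run.P.integrable_const_bound[where B=B]) (auto simp: case_prod_beta')
  interpret NN: pair_prob_space std_normal noise ..
  have resample: "(\<integral>\<xi>. ?G u \<xi> \<partial>noise) = (\<integral>\<xi>. one_step \<theta> t F (u, history z \<phi> \<theta> u \<xi> t) \<partial>noise)"
    if u: "u \<in> space Q" for u
  proof -
    have Gu: "?G u \<in> borel_measurable noise"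
      using measurable_compose[OF measurable_Pair1'[OF u] G] by simp
    have upd: "(\<lambda>(y, \<xi>). \<xi>(t := y)) \<in> std_normal \<Otimes>\<^sub>M noise \<rightarrow>\<^sub>M noise"
      unfolding noise_def
      by (simp add: case_prod_beta', rule measurable_fun_upd[where J=UNIV]) auto
    have "(\<integral>\<xi>. ?G u \<xi> \<partial>noise) = (\<integral>p. ?G u (case p of (y, \<xi>) \<Rightarrow> \<xi>(t := y)) \<partial>(std_normal \<Otimes>\<^sub>M noise))"
      using integral_distr[OF upd Gu] by (simp add: noise_resample)
    also have "\<dots> = (\<integral>(y, \<xi>). ?G u (\<xi>(t := y)) \<partial>(std_normal \<Otimes>\<^sub>M noise))"
      by (simp add: case_prod_beta')
    also have "\<dots> = (\<integral>\<xi>. \<integral>y. ?G u (\<xi>(t := y)) \<partial>std_normal \<partial>noise)"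
      using bound measurable_compose[OF upd Gu]
      by (intro NN.integral_snd[symmetric] NN.P.integrable_const_bound[where B=B]) (auto simp: case_prod_beta')
    also have "\<dots> = (\<integral>\<xi>. one_step \<theta> t F (u, history z \<phi> \<theta> u \<xi> t) \<partial>noise)"
      by (simp add: one_step_def history_Suc history_prefix del: history.simps(2))
    finally show ?thesis .
  qed
  have "(\<integral>p. F (fst p, history z \<phi> \<theta> (fst p) (snd p) (Suc t)) \<partial>run) = (\<integral>u. \<integral>\<xi>. ?G u \<xi> \<partial>noise \<partial>Q)"
    using run.integral_fst'[OF int] by (simp add: case_prod_beta')
  also have "\<dots> = (\<integral>u. \<integral>\<xi>. one_step \<theta> t F (u, history z \<phi> \<theta> u \<xi> t) \<partial>noise \<partial>Q)"
    by (intro Bochner_Integration.integral_cong resample) auto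
  also have "\<dots> = (\<integral>p. one_step \<theta> t F (fst p, history z \<phi> \<theta> (fst p) (snd p) t) \<partial>run)"
    using run.integral_fst'[OF int'] by (simp add: case_prod_beta')
  finally show ?thesis .
qed

section \<open>Change of measure for adaptive sampling\<close>

lemma integrable_choice:
  fixes w :: "real ^ 'n \<Rightarrow> real"
  shows "integrable run (\<lambda>p. w (choice z \<phi> \<theta> (fst p) (snd p) t))"
proof (rule run.P.integrable_const_bound)
  show "AE p in run. norm (w (choice z \<phi> \<theta> (fst p) (snd p) t)) \<le> (\<Sum>x\<in>X. \<bar>w x\<bar>)"
    using finite_X choice_in_X[of _ \<theta> t]
    by (auto intro!: member_le_sum[of _ X "\<lambda>x. \<bar>w x\<bar>"] simp: case_prod_beta')
  show "(\<lambda>p. w (choice z \<phi> \<theta> (fst p) (snd p) t)) \<in> borel_measurable run"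
    by (rule measurable_compose[OF measurable_choice]) simp
qed

definition squared_mean_gap :: "(real ^ 'n) \<times> real \<Rightarrow> (real ^ 'n) \<times> real \<Rightarrow> real ^ 'n \<Rightarrow> real" where
  "squared_mean_gap \<theta> \<theta>' x = (mean_reward \<theta>' x - mean_reward \<theta> x)\<^sup>2"

text \<open>
  The lower half of the Donsker-Varadhan formula for the laws of the histories under \<open>\<theta>\<close> and \<open>\<theta>'\<close>, weakened by
  \<open>1 + v \<le> exp v\<close> so that it is linear in the expectation of \<open>f\<close>. The relative entropy
  is summed over the rounds along the chain rule, by induction: the function \<open>f\<close> of the history
  after round \<open>t\<close> is replaced by the function \<open>g\<close> of the history before it whose exponential is the
  conditional expectation of \<open>exp f\<close> under \<open>\<theta>'\<close>, and the one-step inequality for Gaussian laws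
  compares \<open>g\<close> with the conditional expectation of \<open>f\<close> under \<open>\<theta>\<close>.
\<close>

theorem change_of_measure:
  assumes "f \<in> borel_measurable (Q \<Otimes>\<^sub>M history_space X t)" and "\<And>p. \<bar>f p\<bar> \<le> B"
  shows "1 + (\<integral>p. f (fst p, history z \<phi> \<theta> (fst p) (snd p) t) \<partial>run)
      - (\<Sum>s<t. \<integral>p. squared_mean_gap \<theta> \<theta>' (choice z \<phi> \<theta> (fst p) (snd p) s) \<partial>run) / 2
    \<le> (\<integral>p. exp (f (fst p, history z \<phi> \<theta>' (fst p) (snd p) t)) \<partial>run)"
  using assms
proof (induction t arbitrary: f)
  case 0
  have meas: "(\<lambda>p. f (fst p, \<lambda>_. undefined)) \<in> borel_measurable run"
    using measurable_compose[OF measurable_history "0.prems"(1)] by simp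
  have int: "integrable run (\<lambda>p. f (fst p, \<lambda>_. undefined))"
    using meas "0.prems"(2) by (intro run.P.integrable_const_bound[where B=B]) auto
  have int_exp: "integrable run (\<lambda>p. exp (f (fst p, \<lambda>_. undefined)))"
    using meas abs_le_D1[OF "0.prems"(2)] by (intro run.P.integrable_const_bound[where B="exp B"]) auto
  have "1 + (\<integral>p. f (fst p, \<lambda>_. undefined) \<partial>run) = (\<integral>p. 1 + f (fst p, \<lambda>_. undefined) \<partial>run)"
    using int run.P.prob_space by (subst Bochner_Integration.integral_add) auto
  also have "\<dots> \<le> (\<integral>p. exp (f (fst p, \<lambda>_. undefined)) \<partial>run)"
    using int int_exp by (intro integral_mono) (auto intro: exp_ge_add_one_self)
  finally show ?case
    by simp
next
  case (Suc t)
  note f_meas = Suc.prems(1) and f_bound = Suc.prems(2)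
  define E where "E = one_step \<theta>' t (\<lambda>p. exp (f p))"
  define g where "g p = ln (E p)" for p
  have exp_f_meas: "(\<lambda>p. exp (f p)) \<in> borel_measurable (Q \<Otimes>\<^sub>M history_space X (Suc t))"
    using f_meas by simp
  have exp_f_bounds: "exp (- B) \<le> exp (f p)" "exp (f p) \<le> exp B" for p
    using f_bound[of p] by auto
  have B: "0 \<le> B"
    using order_trans[OF abs_ge_zero f_bound] .
  have E_meas: "E \<in> borel_measurable (Q \<Otimes>\<^sub>M history_space X t)"
    unfolding E_def by (rule measurable_one_step[OF exp_f_meas])
  have E_int_bounds: "exp (- B) \<le> E (u, h) \<and> E (u, h) \<le> exp B"
    if "integrable std_normal (\<lambda>y. exp (f (u, extend \<theta>' t u h y)))" for u h
    using normal.integral_ge_const[OF that, of "exp (- B)"] normal.integral_le_const[OF that, of "exp B"]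
      exp_f_bounds by (simp add: E_def one_step_def)
  have E_bounds: "exp (- B) \<le> E (u, h) \<and> E (u, h) \<le> exp B"
    if p: "(u, h) \<in> space (Q \<Otimes>\<^sub>M history_space X t)" for u h
    using measurable_extend_section[OF exp_f_meas p, of \<theta>'] exp_f_bounds
    by (intro E_int_bounds normal.integrable_const_bound[where B="exp B"]) auto
  have g_bound: "\<bar>g p\<bar> \<le> B" for p
  proof (cases p)
    case (Pair u h)
    show ?thesis
    proof (cases "integrable std_normal (\<lambda>y. exp (f (u, extend \<theta>' t u h y)))")
      case True
      from E_int_bounds[OF this] have "0 < E p" "exp (- B) \<le> E p" "E p \<le> exp B"
        using Pair less_le_trans[OF exp_gt_zero] by auto
      then have "- B \<le> ln (E p)" "ln (E p) \<le> B"
        using ln_mono[of "E p" "exp B"] by (simp_all add: ln_ge_iff)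
      then show ?thesis
        by (simp add: g_def)
    next
      \<comment> \<open>outside the space of histories \<open>E p\<close> may be the default value 0 of an integral, and \<open>ln 0 = 0\<close>\<close>
      case False
      then have "E p = 0"
        by (simp add: E_def one_step_def Pair not_integrable_integral_eq)
      then show ?thesis
        using B by (simp add: g_def)
    qed
  qed
  have g_meas: "g \<in> borel_measurable (Q \<Otimes>\<^sub>M history_space X t)"
    unfolding g_def using E_meas by simp
  have g_lower: "one_step \<theta> t f p - squared_mean_gap \<theta> \<theta>' (\<phi> t (fst p) (snd p)) / 2 \<le> g p"
    if p: "p \<in> space (Q \<Otimes>\<^sub>M history_space X t)" for p
  proof (cases p)
    case (Pair u h)
    let ?x = "\<phi> t u h"
    let ?d = "mean_reward \<theta>' ?x - mean_reward \<theta> ?x"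
    \<comment> \<open>on a fixed history both parameters lead to the same choice, so only the mean of the reward moves\<close>
    have shift: "extend \<theta>' t u h y = extend \<theta> t u h (?d + y)" for y
      by (simp add: extend_def)
    show ?thesis
      using gaussian_shift_variational[OF measurable_extend_section[OF f_meas, of u h \<theta>] f_bound, of 0 ?d] p Pair
      by (simp add: g_def E_def one_step_def shift squared_mean_gap_def)
  qed
  let ?h = "\<lambda>\<theta> p. (fst p, history z \<phi> \<theta> (fst p) (snd p) t)"
  have h_space: "?h \<theta> p \<in> space (Q \<Otimes>\<^sub>M history_space X t)" if "p \<in> space run" for p \<theta>
    using measurable_space[OF measurable_history that] by simp
  have bounded_int: "integrable run (\<lambda>p. F (?h \<theta> p))"
    if "F \<in> borel_measurable (Q \<Otimes>\<^sub>M history_space X t)" "\<And>p. \<bar>F p\<bar> \<le> B" for F \<theta>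
    using measurable_compose[OF measurable_history that(1)] that(2)
    by (intro run.P.integrable_const_bound[where B=B]) auto
  have one_step_bound: "\<bar>one_step \<theta> t f p\<bar> \<le> B" for p
    by (rule one_step_bounded[OF f_bound])
  have gap_int: "integrable run (\<lambda>p. squared_mean_gap \<theta> \<theta>' (choice z \<phi> \<theta> (fst p) (snd p) t))"
    by (rule integrable_choice)
  have "(\<integral>p. f (fst p, history z \<phi> \<theta> (fst p) (snd p) (Suc t)) \<partial>run)
      - (\<integral>p. squared_mean_gap \<theta> \<theta>' (choice z \<phi> \<theta> (fst p) (snd p) t) \<partial>run) / 2
    = (\<integral>p. one_step \<theta> t f (?h \<theta> p) - squared_mean_gap \<theta> \<theta>' (choice z \<phi> \<theta> (fst p) (snd p) t) / 2 \<partial>run)"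
    using bounded_int[OF measurable_one_step[OF f_meas] one_step_bound] gap_int
    by (simp add: integral_history_Suc[OF f_meas f_bound] del: history.simps(2))
  also have "\<dots> \<le> (\<integral>p. g (?h \<theta> p) \<partial>run)"
    using bounded_int[OF measurable_one_step[OF f_meas] one_step_bound] gap_int
      bounded_int[OF g_meas g_bound] g_lower[OF h_space]
    by (intro integral_mono) (auto simp: choice_def)
  finally have step: "(\<integral>p. f (fst p, history z \<phi> \<theta> (fst p) (snd p) (Suc t)) \<partial>run)
      - (\<integral>p. squared_mean_gap \<theta> \<theta>' (choice z \<phi> \<theta> (fst p) (snd p) t) \<partial>run) / 2
    \<le> (\<integral>p. g (?h \<theta> p) \<partial>run)" .
  have "(\<integral>p. exp (g (?h \<theta>' p)) \<partial>run) = (\<integral>p. E (?h \<theta>' p) \<partial>run)"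
  proof (rule Bochner_Integration.integral_cong[OF refl])
    fix p assume "p \<in> space run"
    from E_bounds[OF h_space[OF this]] have "0 < E (?h \<theta>' p)"
      using less_le_trans[OF exp_gt_zero] by blast
    then show "exp (g (?h \<theta>' p)) = E (?h \<theta>' p)"
      by (simp add: g_def)
  qed
  also have "\<dots> = (\<integral>p. exp (f (fst p, history z \<phi> \<theta>' (fst p) (snd p) (Suc t))) \<partial>run)"
    unfolding E_def using exp_f_bounds(2)
    by (intro integral_history_Suc[OF exp_f_meas, symmetric, where B="exp B"]) simp
  finally show ?case
    using Suc.IH[OF g_meas g_bound] step by (simp del: history.simps(2) add: add_divide_distrib)
qed

section \<open>Expected numbers of plays\<close>

definition pulls :: "(real ^ 'n) \<times> real \<Rightarrow> nat \<Rightarrow> real ^ 'n \<Rightarrow> real" where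
  "pulls \<theta> T x = (\<Sum>t<T. \<integral>p. indicator {x} (choice z \<phi> \<theta> (fst p) (snd p) t) \<partial>run)"

lemma pulls_nonneg: "0 \<le> pulls \<theta> T x"
  unfolding pulls_def by (intro sum_nonneg integral_nonneg_AE) auto

lemma sum_expectation_choice:
  "(\<Sum>t<T. \<integral>p. w (choice z \<phi> \<theta> (fst p) (snd p) t) \<partial>run) = (\<Sum>x\<in>X. w x * pulls \<theta> T x)"
proof -
  have "(\<integral>p. w (choice z \<phi> \<theta> (fst p) (snd p) t) \<partial>run) =
      (\<Sum>x\<in>X. w x * (\<integral>p. indicator {x} (choice z \<phi> \<theta> (fst p) (snd p) t) \<partial>run))" for t
  proof -
    have "(\<integral>p. w (choice z \<phi> \<theta> (fst p) (snd p) t) \<partial>run) =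
      (\<integral>p. (\<Sum>x\<in>X. w x * indicator {x} (choice z \<phi> \<theta> (fst p) (snd p) t)) \<partial>run)"
      using finite_X choice_in_X[of _ \<theta> t]
      by (intro Bochner_Integration.integral_cong) (auto simp: indicator_def if_distrib cong: if_cong)
    also have "\<dots> = (\<Sum>x\<in>X. w x * (\<integral>p. indicator {x} (choice z \<phi> \<theta> (fst p) (snd p) t) \<partial>run))"
      by (subst Bochner_Integration.integral_sum) (auto intro: integrable_choice)
    finally show ?thesis .
  qed
  then show ?thesis
    by (simp add: pulls_def sum_distrib_left sum.swap[of _ X])
qed

lemma sum_pulls: "(\<Sum>x\<in>X. pulls \<theta> T x) = real T"
  using sum_expectation_choice[of "\<lambda>_. 1" \<theta> T] run.P.prob_space by simp

text \<open>
  The functional that is tested is \<open>c\<close> times the fraction of rounds in which \<open>a\<close> is played. By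
  convexity its exponential lies below the chord of \<open>exp\<close> over \<open>[0, c]\<close>, which is affine in the number
  of plays; this turns the exponential moment under \<open>\<theta>'\<close> into an expected number of plays.
\<close>

theorem pulls_change_of_measure:
  assumes a: "a \<in> X" and T: "0 < T" and c: "0 \<le> c"
  shows "c * (pulls \<theta> T a / T) - (exp c - 1) * (pulls \<theta>' T a / T)
    \<le> (\<Sum>x\<in>X. squared_mean_gap \<theta> \<theta>' x * pulls \<theta> T x) / 2"
proof -
  define share :: "real \<times> 'n history \<Rightarrow> real" where
    "share p = (\<Sum>s<T. indicator {a} (fst (snd p s))) / T" for p
  have share_range: "0 \<le> share p" "share p \<le> 1" for p
  proof -
    have "(\<Sum>s<T. indicator {a} (fst (snd p s))) \<le> (\<Sum>s<T. 1 :: real)"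
      by (intro sum_mono) (simp add: indicator_def)
    then show "0 \<le> share p" "share p \<le> 1"
      using T by (auto simp: share_def divide_le_eq intro!: divide_nonneg_nonneg sum_nonneg)
  qed
  have share_meas: "share \<in> borel_measurable (Q \<Otimes>\<^sub>M history_space X T)"
  proof -
    have "(\<lambda>p. indicator {a} (fst (snd p s)) :: real) \<in> borel_measurable (Q \<Otimes>\<^sub>M history_space X T)"
      if "s < T" for s
    proof -
      have "(\<lambda>h. fst (h s)) \<in> history_space X T \<rightarrow>\<^sub>M count_space X"
        unfolding history_space_def
        using that measurable_compose[OF measurable_component_singleton[of s "{..<T}"
              "\<lambda>_. count_space X \<Otimes>\<^sub>M (borel :: real measure)"] measurable_fst]
        by simp
      from measurable_compose[OF measurable_compose[OF measurable_snd this], of "indicator {a}" borel Q]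
      show ?thesis by simp
    qed
    then show ?thesis
      unfolding share_def by (intro borel_measurable_divide borel_measurable_sum) auto
  qed
  let ?h = "\<lambda>\<theta> p. (fst p, history z \<phi> \<theta> (fst p) (snd p) T)"
  have share_int: "integrable run (\<lambda>p. share (?h \<theta> p))" for \<theta>
    using measurable_compose[OF measurable_history share_meas] share_range
    by (intro run.P.integrable_const_bound[where B=1]) auto
  have share_mean: "(\<integral>p. share (?h \<theta> p) \<partial>run) = pulls \<theta> T a / T" for \<theta>
  proof -
    have "(\<integral>p. share (?h \<theta> p) \<partial>run) =
        (\<integral>p. (\<Sum>s<T. indicator {a} (choice z \<phi> \<theta> (fst p) (snd p) s)) / T \<partial>run)"
      by (simp add: share_def history_entry)
    also have "\<dots> = pulls \<theta> T a / T"
      unfolding pulls_def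
      by (subst Bochner_Integration.integral_divide_zero, subst Bochner_Integration.integral_sum)
        (auto intro: integrable_choice)
    finally show ?thesis .
  qed
  have exp_chord: "exp (c * share p) \<le> 1 + (exp c - 1) * share p" for p
    using convex_onD[OF exp_convex, of "share p" 0 c] share_range[of p]
    by (simp add: algebra_simps)
  have exp_int: "integrable run (\<lambda>p. exp (c * share (?h \<theta>' p)))"
    using measurable_compose[OF measurable_history share_meas] share_range c
    by (intro run.P.integrable_const_bound[where B="exp c"]) (auto intro!: mult_left_le)
  have "1 + c * (pulls \<theta> T a / T) - (\<Sum>x\<in>X. squared_mean_gap \<theta> \<theta>' x * pulls \<theta> T x) / 2
      \<le> (\<integral>p. exp (c * share (?h \<theta>' p)) \<partial>run)"
    using change_of_measure[of "\<lambda>p. c * share p" T c \<theta> \<theta>'] share_meas share_range c share_mean[of \<theta>]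
    by (simp add: sum_expectation_choice mult_left_le abs_mult)
  also have "\<dots> \<le> (\<integral>p. 1 + (exp c - 1) * share (?h \<theta>' p) \<partial>run)"
    using exp_int share_int exp_chord by (intro integral_mono) auto
  also have "\<dots> = 1 + (exp c - 1) * (pulls \<theta>' T a / T)"
    using share_int[of \<theta>'] share_mean[of \<theta>'] run.P.prob_space
    by (subst Bochner_Integration.integral_add) auto
  finally show ?thesis
    by linarith
qed

lemma regret_eq_sum_pulls:
  "regret X z Q \<phi> \<theta> T = (\<Sum>x\<in>X. ((arg_max_on (\<lambda>x. x \<bullet> fst \<theta>) X - x) \<bullet> fst \<theta>) * pulls \<theta> T x)"
  unfolding regret_def case_prod_beta'
  by (subst Bochner_Integration.integral_sum)
    (auto simp: sum_expectation_choice[symmetric] intro: integrable_choice[where w="\<lambda>x. (_ - x) \<bullet> _"])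

end

section \<open>Logarithmic regret forces exploration\<close>

text \<open>
  The right-hand side bounds \<open>c * (pulls \<theta> T a / T) - (exp c - 1) * (pulls \<theta>' T a / T)\<close> from below for
  \<open>c = 3/4 log T\<close>, if other actions than \<open>a\<close> are played at most \<open>r log T\<close> times under \<open>\<theta>\<close>, and \<open>a\<close> at
  most that often under \<open>\<theta>'\<close>, in expectation. For this \<open>c\<close> the subtracted term is of
  order \<open>T\<^sup>-\<^sup>1\<^sup>/\<^sup>4 log T\<close>, so the factor on the left can be any number below 3/4; the bias estimation bound
  needs 2/3.
\<close>

definition long_horizon :: "real \<Rightarrow> nat \<Rightarrow> bool" where
  "long_horizon r T \<longleftrightarrow>
    2/3 * ln (real T) \<le>
      3/4 * ln (real T) * (1 - r * ln (real T) / real T)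
      - exp (3/4 * ln (real T)) * (r * ln (real T) / real T)"

lemma eventually_long_horizon:
  assumes "0 < r"
  shows "\<forall>\<^sub>F T in sequentially. long_horizon r T"
  unfolding long_horizon_def using assms by real_asymp

definition separated_best :: "(real ^ 'n) set \<Rightarrow> real ^ 'n \<Rightarrow> real ^ 'n \<Rightarrow> real \<Rightarrow> bool" where
  "separated_best X \<gamma> a D \<longleftrightarrow> a \<in> X \<and> (\<forall>x\<in>X. x \<noteq> a \<longrightarrow> D \<le> (a - x) \<bullet> \<gamma>)"

lemma separated_best_is_arg_max:
  assumes "separated_best X \<gamma> a D" "0 < D"
  shows "is_arg_max (\<lambda>x. x \<bullet> \<gamma>) (\<lambda>x. x \<in> X) x \<longleftrightarrow> x = a"
proof -
  have less: "x \<bullet> \<gamma> < a \<bullet> \<gamma>" if "x \<in> X" "x \<noteq> a" for x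
    using assms that by (auto simp: separated_best_def inner_diff_left intro: less_le_trans)
  then show ?thesis
    using assms(1) unfolding is_arg_max_def separated_best_def
    by (metis order_less_asym)
qed

lemma separated_best_arg_max_on:
  assumes "separated_best X \<gamma> a D" "0 < D"
  shows "arg_max_on (\<lambda>x. x \<bullet> \<gamma>) X = a"
  unfolding arg_max_on_def arg_max_def separated_best_is_arg_max[OF assms] by simp

context bandit begin

lemma sum_gap_pulls_le_regret:
  assumes best: "separated_best X (fst \<theta>) a D" and D: "0 < D" and Y: "Y \<subseteq> X"
  shows "(\<Sum>x\<in>Y. ((a - x) \<bullet> fst \<theta>) * pulls \<theta> T x) \<le> regret X z Q \<phi> \<theta> T"
  unfolding regret_eq_sum_pulls separated_best_arg_max_on[OF best D]
proof (rule sum_mono2[OF finite_X Y])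
  fix x assume "x \<in> X - Y"
  then have "0 \<le> (a - x) \<bullet> fst \<theta>"
    using best D by (cases "x = a") (auto simp: separated_best_def intro: order_trans[OF less_imp_le])
  then show "0 \<le> ((a - x) \<bullet> fst \<theta>) * pulls \<theta> T x"
    using pulls_nonneg by simp
qed

lemma suboptimal_pulls_le_regret:
  assumes best: "separated_best X (fst \<theta>) a D" and D: "0 < D"
  shows "D * (\<Sum>x\<in>X - {a}. pulls \<theta> T x) \<le> regret X z Q \<phi> \<theta> T"
proof -
  have "D * (\<Sum>x\<in>X - {a}. pulls \<theta> T x) \<le> (\<Sum>x\<in>X - {a}. ((a - x) \<bullet> fst \<theta>) * pulls \<theta> T x)"
    unfolding sum_distrib_left using best pulls_nonneg
    by (intro sum_mono mult_right_mono) (auto simp: separated_best_def)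
  also have "\<dots> \<le> regret X z Q \<phi> \<theta> T"
    by (intro sum_gap_pulls_le_regret[OF best D]) auto
  finally show ?thesis .
qed

text \<open>
  Every play of an action other than the best one costs at least \<open>D\<close>, so that regret at most \<open>B log T\<close>
  allows at most \<open>B / D log T\<close> such plays. The best action \<open>a\<close> of \<open>\<theta>\<close> is thus frequent under \<open>\<theta>\<close> and
  rare under \<open>\<theta>'\<close>, and the difference has to be paid in relative entropy.
\<close>

theorem small_regret_forces_exploration:
  assumes best: "separated_best X (fst \<theta>) a D" and best': "separated_best X (fst \<theta>') a' D"
    and ne: "a \<noteq> a'" and D: "0 < D" and T: "0 < T"
    and regret: "regret X z Q \<phi> \<theta> T \<le> B * ln T" and regret': "regret X z Q \<phi> \<theta>' T \<le> B * ln T"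
    and horizon: "long_horizon (B / D) T"
  shows "2/3 * ln (real T) \<le> (\<Sum>x\<in>X. squared_mean_gap \<theta> \<theta>' x * pulls \<theta> T x) / 2"
proof -
  let ?L = "ln (real T)"
  have L: "0 \<le> ?L"
    using T by simp
  have a: "a \<in> X"
    using best by (simp add: separated_best_def)
  have "real T - pulls \<theta> T a = (\<Sum>x\<in>X - {a}. pulls \<theta> T x)"
    using sum_pulls[of \<theta> T] sum.remove[OF finite_X a, of "pulls \<theta> T"] by simp
  also have "\<dots> \<le> B / D * ?L"
    using suboptimal_pulls_le_regret[OF best D, of T] regret D by (simp add: field_simps)
  finally have frequent: "1 - B / D * ?L / T \<le> pulls \<theta> T a / T"
    using T by (simp add: field_simps)
  have "pulls \<theta>' T a \<le> (\<Sum>x\<in>X - {a'}. pulls \<theta>' T x)"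
    using a ne finite_X pulls_nonneg by (intro member_le_sum) auto
  also have "\<dots> \<le> B / D * ?L"
    using suboptimal_pulls_le_regret[OF best' D, of T] regret' D by (simp add: field_simps)
  finally have rare: "pulls \<theta>' T a / T \<le> B / D * ?L / T"
    by (rule divide_right_mono) simp
  have "(exp (3/4 * ?L) - 1) * (pulls \<theta>' T a / T) \<le> exp (3/4 * ?L) * (B / D * ?L / T)"
    using rare pulls_nonneg[of \<theta>' T a] L by (intro mult_mono) auto
  moreover have "3/4 * ?L * (1 - B / D * ?L / T) \<le> 3/4 * ?L * (pulls \<theta> T a / T)"
    using L frequent by (intro mult_left_mono) auto
  ultimately show ?thesis
    using pulls_change_of_measure[OF a T, of "3/4 * ?L" \<theta> \<theta>'] L horizon unfolding long_horizon_def by linarith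
qed

end

section \<open>Upper bounds on the bias estimation cost\<close>

lemma design_matrix_mult:
  fixes z :: "real ^ 'n::finite \<Rightarrow> real"
  shows "design_matrix X z \<mu> *v u = (\<Sum>x\<in>X. (\<mu> x * (action z x \<bullet> u)) *\<^sub>R action z x)"
proof -
  have rank_one: "(\<chi> i j. a $ i * a $ j) *v u = (a \<bullet> u) *\<^sub>R a" for a :: "real ^ ('n option)"
    by (simp add: vec_eq_iff matrix_vector_mult_def inner_vec_def sum_distrib_left sum_distrib_right mult_ac)
  have sum: "(\<Sum>x\<in>A. F x) *v u = (\<Sum>x\<in>A. F x *v u)"
    for A :: "(real ^ 'n) set" and F :: "_ \<Rightarrow> real ^ ('n option) ^ ('n option)"
    by (induction A rule: infinite_finite_induct) (auto simp: matrix_vector_mult_add_rdistrib)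
  show ?thesis
    unfolding design_matrix_def sum
    by (simp add: scaleR_matrix_vector_assoc[symmetric] rank_one)
qed

text \<open>
  A solution \<open>u\<close> of \<open>V(\<mu>) u = e_last\<close> certifies admissibility of the design \<open>\<mu>\<close>: by symmetry of \<open>V(\<mu>)\<close> the
  quadratic form of any generalized inverse at \<open>e_last\<close> equals \<open>u \<bullet> V(\<mu>) u\<close>, the last coordinate of \<open>u\<close>.
\<close>

lemma kappa_le_weighted_gap:
  assumes nonneg: "\<And>x. x \<in> X \<Longrightarrow> 0 \<le> \<mu> x" "\<And>x. x \<in> X \<Longrightarrow> 0 \<le> \<Delta> x"
    and u: "design_matrix X z \<mu> *v u = e_last" and u_le: "u $ None \<le> 1"
  shows "kappa X z \<Delta> \<le> (\<Sum>x\<in>X. \<mu> x * \<Delta> x)"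
  unfolding kappa_def
proof (rule cInf_lower)
  let ?M = "design_matrix X z \<mu>"
  let ?G = "gen_inverse ?M"
  have sym: "transpose ?M = ?M"
    by (simp add: design_matrix_def transpose_def vec_eq_iff mult.commute)
  have "e_last \<bullet> (?G *v e_last) = u \<bullet> (?M *v (?G *v (?M *v u)))"
    using sym u by (metis dot_lmul_matrix vector_transpose_matrix)
  also have "\<dots> = u \<bullet> (?M *v u)"
    using is_gen_inverse_gen_inverse[of ?M]
    by (simp add: is_gen_inverse_def matrix_vector_mul_assoc matrix_mul_assoc)
  also have "\<dots> = u $ None"
    by (simp add: u inner_axis)
  finally have "e_last \<bullet> (?G *v e_last) \<le> 1"
    using u_le by simp
  moreover have "e_last \<in> range ((*v) ?M)"
    using u by (metis rangeI)
  ultimately show "(\<Sum>x\<in>X. \<mu> x * \<Delta> x) \<in> {\<Sum>x\<in>X. \<mu> x * \<Delta> x |\<mu>. (\<forall>x\<in>X. 0 \<le> \<mu> x) \<and>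
      e_last \<in> range ((*v) (design_matrix X z \<mu>)) \<and>
      e_last \<bullet> (gen_inverse (design_matrix X z \<mu>) *v e_last) \<le> 1}"
    using nonneg by blast
  show "bdd_below {\<Sum>x\<in>X. \<mu> x * \<Delta> x |\<mu>. (\<forall>x\<in>X. 0 \<le> \<mu> x) \<and>
      e_last \<in> range ((*v) (design_matrix X z \<mu>)) \<and>
      e_last \<bullet> (gen_inverse (design_matrix X z \<mu>) *v e_last) \<le> 1}"
    using nonneg(2) by (intro bdd_belowI[of _ 0]) (auto intro!: sum_nonneg)
qed


section \<open>The hard action set\<close>

locale hard_instance =
  fixes c :: real and i1 i2 :: "'n::finite"
  assumes c: "0 \<le> c" "c < 1" and i1_i2: "i1 \<noteq> i2"
begin

text \<open>
  With its label the probe is \<open>(- c e\<^sub>1, - 1)\<close>, while \<open>e\<^sub>1\<close> with its label is \<open>(e\<^sub>1, 1)\<close>. As \<open>c\<close> tends to 1, these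
  two actions become collinear, so that \<open>c\<close> tunes how hard the bias is to estimate.
\<close>

definition probe :: "real ^ 'n" where
  "probe = - c *\<^sub>R axis i1 1"

definition X :: "(real ^ 'n) set" where
  "X = insert probe (range (\<lambda>i. axis i 1))"

definition z :: "real ^ 'n \<Rightarrow> real" where
  "z x = (if x = axis i2 1 \<or> x = probe then - 1 else 1)"

lemma probe_neq_axis [simp]: "probe \<noteq> axis i 1" "axis i 1 \<noteq> probe"
proof -
  have "probe $ i \<noteq> 1"
    using c by (auto simp: probe_def axis_def)
  then show "probe \<noteq> axis i 1" "axis i 1 \<noteq> probe"
    by (metis axis_nth)+
qed

lemma z_axis [simp]: "z (axis i 1) = (if i = i2 then - 1 else 1)"
  by (auto simp: z_def axis_eq_axis)

lemma z_probe [simp]: "z probe = - 1"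
  by (simp add: z_def)

lemma axis_in_X [simp]: "axis i 1 \<in> X" and probe_in_X [simp]: "probe \<in> X"
  by (auto simp: X_def)

lemma finite_actions: "finite X"
  by (simp add: X_def)

lemma sum_X: "(\<Sum>x\<in>X. f x) = f probe + (\<Sum>i\<in>UNIV. f (axis i 1 :: real ^ 'n))"
proof -
  have "inj (\<lambda>i. axis i 1 :: real ^ 'n)"
    by (auto simp: inj_def axis_eq_axis)
  moreover have "probe \<notin> range (\<lambda>i. axis i 1 :: real ^ 'n)"
    by auto
  ultimately show ?thesis
    unfolding X_def by (simp add: sum.reindex)
qed

lemma axis_inner [simp]: "axis i 1 \<bullet> \<gamma> = \<gamma> $ i" and probe_inner [simp]: "probe \<bullet> \<gamma> = - (c * \<gamma> $ i1)"
  for \<gamma> :: "real ^ 'n"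
  by (simp_all add: probe_def inner_axis')

lemma action_axis: "action z (axis i 1) = axis (Some i) 1 + z (axis i 1) *\<^sub>R e_last"
  by (auto simp: vec_eq_iff action_def axis_def split: option.split)

lemma action_probe: "action z probe = - c *\<^sub>R axis (Some i1) 1 - e_last"
proof -
  have "probe $ j = (if j = i1 then - c else 0)" for j
    by (simp add: probe_def axis_def)
  then show ?thesis
    by (simp add: vec_eq_iff action_def split: option.split) (simp add: axis_def)
qed

lemma action_set: "action_set X z"
proof -
  let ?S = "span (action z ` X)"
  have "(1 - c) *\<^sub>R e_last = - (c *\<^sub>R action z (axis i1 1) + action z probe)"
    using i1_i2 by (simp add: action_axis action_probe algebra_simps)
  also have "\<dots> \<in> ?S"
    by (intro span_neg span_add span_scale span_base imageI axis_in_X probe_in_X)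
  finally have "(1 - c) *\<^sub>R e_last \<in> ?S" .
  then have "(1 / (1 - c)) *\<^sub>R (1 - c) *\<^sub>R e_last \<in> ?S"
    by (rule span_scale)
  then have last: "e_last \<in> ?S"
    using c by simp
  have coordinate: "axis (Some i) 1 \<in> ?S" for i
  proof -
    have "axis (Some i) 1 = action z (axis i 1) - z (axis i 1) *\<^sub>R e_last"
      by (simp add: action_axis)
    also have "\<dots> \<in> ?S"
      by (intro span_diff span_scale[OF last] span_base imageI axis_in_X)
    finally show ?thesis .
  qed
  have "Basis \<subseteq> ?S"
  proof
    fix v :: "real ^ ('n option)" assume "v \<in> Basis"
    then obtain j where "v = axis j 1"
      by (auto simp: Basis_vec_def)
    then show "v \<in> ?S"
      using last coordinate by (cases j) auto
  qed
  then have "?S = UNIV"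
    using span_mono[of Basis ?S] by (auto simp: span_span)
  then show ?thesis
    unfolding action_set_def using finite_actions i1_i2
    by (auto simp: X_def intro!: bexI[of _ probe])
qed

text \<open>
  The bias is a combination of the actions at \<open>e\<^sub>1\<close> and at the probe, with coefficients \<open>- c / (1 - c)\<close> and
  \<open>- 1 / (1 - c)\<close>. The design gives both the weight \<open>2 / (1 - c)\<^sup>2\<close>, for which the variance of this
  estimator is \<open>(1 + c\<^sup>2) / 2 \<le> 1\<close>.
\<close>

lemma kappa_le:
  assumes "\<And>x. x \<in> X \<Longrightarrow> 0 \<le> \<Delta> x"
  shows "kappa X z \<Delta> \<le> 2 / (1 - c)\<^sup>2 * (\<Delta> (axis i1 1) + \<Delta> probe)"
proof -
  define m where "m = 2 / (1 - c)\<^sup>2"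
  define \<mu> :: "real ^ 'n \<Rightarrow> real" where "\<mu> x = (if x = axis i1 1 \<or> x = probe then m else 0)" for x
  \<comment> \<open>the solution whose inner products with the two actions are their coefficients divided by \<open>m\<close>\<close>
  define u :: "real ^ ('n option)" where
    "u = ((1 + c\<^sup>2) / 2) *\<^sub>R e_last - ((1 + c) / 2) *\<^sub>R axis (Some i1) 1"
  have \<mu>_axis: "\<mu> (axis i 1) = (if i = i1 then m else 0)" for i
    by (auto simp: \<mu>_def axis_eq_axis)
  have \<mu>_probe: "\<mu> probe = m"
    by (simp add: \<mu>_def)
  have sum_\<mu>: "(\<Sum>x\<in>X. \<mu> x *\<^sub>R f x) = m *\<^sub>R (f (axis i1 1) + f probe)" 
    for f :: "real ^ 'n \<Rightarrow> 'b::real_vector"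
    by (simp add: sum_X \<mu>_axis \<mu>_probe if_distrib[where f="\<lambda>r. r *\<^sub>R _"] scaleR_add_right cong: if_cong)
  have u_nth: "u $ None = (1 + c\<^sup>2) / 2" "u $ Some i1 = - (1 + c) / 2"
    by (simp_all add: u_def axis_def field_simps)
  have u_axis: "action z (axis i1 1) \<bullet> u = - (c * (1 - c) / 2)"
    using i1_i2 by (simp add: action_axis inner_add_left inner_axis' u_nth power2_eq_square field_simps)
  have u_probe: "action z probe \<bullet> u = - ((1 - c) / 2)"
    by (simp add: action_probe inner_diff_left inner_axis' u_nth power2_eq_square field_simps)
  have "design_matrix X z \<mu> *v u = (\<Sum>x\<in>X. \<mu> x *\<^sub>R ((action z x \<bullet> u) *\<^sub>R action z x))"
    by (simp add: design_matrix_mult)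
  also have "\<dots> = (m * (1 - c)\<^sup>2 / 2) *\<^sub>R e_last"
    unfolding sum_\<mu> u_axis u_probe using i1_i2
    by (simp add: action_axis action_probe vec_eq_iff power2_eq_square field_simps)
  also have "m * (1 - c)\<^sup>2 / 2 = 1"
    using c by (simp add: m_def)
  finally have u: "design_matrix X z \<mu> *v u = e_last"
    by simp
  have "c\<^sup>2 \<le> 1"
    using c by (simp add: power_le_one)
  then have "u $ None \<le> 1"
    by (simp add: u_nth)
  moreover have "0 \<le> \<mu> x" for x
    by (simp add: \<mu>_def m_def)
  ultimately have "kappa X z \<Delta> \<le> (\<Sum>x\<in>X. \<mu> x * \<Delta> x)"
    using u assms by (intro kappa_le_weighted_gap) auto
  then show ?thesis
    using sum_\<mu>[of \<Delta>] by (simp add: m_def)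
qed

lemma gap_eq:
  assumes "separated_best X \<gamma> a D" "0 < D"
  shows "gap X \<gamma> x = (a - x) \<bullet> \<gamma>"
  unfolding gap_def
proof (rule Max_eqI)
  show "finite ((\<lambda>x'. (x' - x) \<bullet> \<gamma>) ` X)"
    using finite_actions by simp
  show "(a - x) \<bullet> \<gamma> \<in> (\<lambda>x'. (x' - x) \<bullet> \<gamma>) ` X"
    using assms by (simp add: separated_best_def)
  show "y \<le> (a - x) \<bullet> \<gamma>" if "y \<in> (\<lambda>x'. (x' - x) \<bullet> \<gamma>) ` X" for y
    using that assms by (force simp: separated_best_def inner_diff_left)
qed

text \<open>
  The gaps of \<open>e\<^sub>1\<close> and of the probe add up to \<open>2 \<gamma>\<^sub>b - (1 - c) \<gamma>\<^sub>1 \<le> 1\<close>, so the design on these two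
  actions costs at most \<open>2 / (1 - c)\<^sup>2\<close>. The probe has a nonpositive value, hence a gap of at least \<open>\<gamma>\<^sub>b\<close>.
\<close>

lemma in_gap_kappa_class:
  assumes \<gamma>: "\<And>i. 0 \<le> \<gamma> $ i" "\<gamma> $ b \<le> 1 / 2"
    and \<Delta>: "0 < \<Delta>min" "\<Delta>min \<le> \<Delta>neq" "\<Delta>neq \<le> \<gamma> $ b"
    and gap_min: "\<And>i. i \<noteq> b \<Longrightarrow> \<gamma> $ i + \<Delta>min \<le> \<gamma> $ b"
    and gap_neq: "\<And>i. (i = i2) \<noteq> (b = i2) \<Longrightarrow> \<gamma> $ i + \<Delta>neq \<le> \<gamma> $ b"
  shows "separated_best X \<gamma> (axis b 1) \<Delta>min"
    and "(\<gamma>, \<omega>) \<in> gap_kappa_class X z \<Delta>min \<Delta>neq (2 / (1 - c)\<^sup>2)"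
proof -
  have c_\<gamma>: "0 \<le> c * \<gamma> $ i1" "c * \<gamma> $ i1 \<le> \<gamma> $ i1"
    using c \<gamma>(1) by (auto intro: mult_left_le_one_le)
  have \<gamma>_le: "\<gamma> $ i \<le> \<gamma> $ b" for i
    using gap_min[of i] \<Delta> by (cases "i = b") auto
  show best: "separated_best X \<gamma> (axis b 1) \<Delta>min"
    using gap_min \<Delta> c_\<gamma> by (force simp: separated_best_def X_def inner_diff_left)
  have "\<bar>\<gamma> $ i\<bar> \<le> 1" for i
    using \<gamma>(1)[of i] \<gamma>_le[of i] \<gamma>(2) by linarith
  moreover have "\<bar>c * \<gamma> $ i1\<bar> \<le> 1"
    using c_\<gamma> \<gamma>_le[of i1] \<gamma>(2) by linarith
  ultimately have bounded: "\<gamma> \<in> bounded_params X"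
    by (auto simp: bounded_params_def X_def)
  have "(\<forall>x'\<in>X. z x' \<noteq> z (axis b 1) \<longrightarrow> \<Delta>neq \<le> (axis b 1 - x') \<bullet> \<gamma>)"
    using gap_neq \<Delta> c_\<gamma> by (force simp: X_def inner_diff_left split: if_splits)
  moreover have "{x. is_arg_max (\<lambda>x. x \<bullet> \<gamma>) (\<lambda>x. x \<in> X) x} = {axis b 1}"
    using separated_best_is_arg_max[OF best \<Delta>(1)] by auto
  ultimately have "(\<gamma>, \<omega>) \<in> gap_class X z \<Delta>min \<Delta>neq"
    using best bounded by (auto simp: gap_class_def separated_best_def)
  moreover have "kappa X z (gap X \<gamma>) \<le> 2 / (1 - c)\<^sup>2"
  proof -
    have "kappa X z (gap X \<gamma>) \<le> 2 / (1 - c)\<^sup>2 * (gap X \<gamma> (axis i1 1) + gap X \<gamma> probe)"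
      using best \<Delta>(1) unfolding gap_eq[OF best \<Delta>(1)]
      by (intro kappa_le) (force simp: separated_best_def inner_diff_left)
    also have "\<dots> \<le> 2 / (1 - c)\<^sup>2 * 1"
      using c_\<gamma> \<gamma>(2) unfolding gap_eq[OF best \<Delta>(1)]
      by (intro mult_left_mono) (auto simp: inner_diff_left)
    finally show ?thesis
      by simp
  qed
  ultimately show "(\<gamma>, \<omega>) \<in> gap_kappa_class X z \<Delta>min \<Delta>neq (2 / (1 - c)\<^sup>2)"
    using bounded by (simp add: gap_kappa_class_def)
qed

end

context hard_instance begin

section \<open>The two lower bounds\<close>

text \<open>
  In both lower bounds the base value 3/8 leaves room to raise an entry by \<open>\<Delta>min < 1/8\<close> and stay below
  1/2, the upper limit for the bound on \<open>\<kappa>\<close>, and to lower an entry by \<open>2 \<Delta>neq < 1/4\<close> and stay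
  nonnegative.
\<close>

lemma same_group_lower_bound:
  fixes B :: real and Q :: "real measure" and \<phi> :: "nat \<Rightarrow> real \<Rightarrow> 'n history \<Rightarrow> real ^ 'n"
  assumes algorithm: "bandit_algorithm X Q \<phi>"
    and \<Delta>: "0 < \<Delta>min" "\<Delta>min \<le> \<Delta>neq" "\<Delta>neq < 1/8" and T: "0 < T"
    and regret: "\<And>\<theta>. \<theta> \<in> gap_kappa_class X z \<Delta>min \<Delta>neq (2 / (1 - c)\<^sup>2) \<Longrightarrow>
      regret X z Q \<phi> \<theta> T \<le> B * ln (real T)"
    and horizon: "long_horizon (B / \<Delta>min) T"
  shows "\<exists>\<theta>\<in>gap_kappa_class X z \<Delta>min \<Delta>neq (2 / (1 - c)\<^sup>2).
    (real CARD('n) - 2) / (3 * \<Delta>min) * ln (real T) \<le> regret X z Q \<phi> \<theta> T"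
proof -
  interpret bandit X z Q \<phi>
    using finite_actions algorithm by unfold_locales
  define \<gamma> :: "real ^ 'n" where
    "\<gamma> = (\<chi> i. if i = i1 then 3/8 else if i = i2 then 3/8 - \<Delta>neq else 3/8 - \<Delta>min)"
  define \<gamma>' :: "'n \<Rightarrow> real ^ 'n" where
    "\<gamma>' k = (\<chi> i. if i = k then 3/8 + \<Delta>min else \<gamma> $ i)" for k
  have \<gamma>_best: "separated_best X \<gamma> (axis i1 1) \<Delta>min"
    and \<gamma>_class: "(\<gamma>, 0) \<in> gap_kappa_class X z \<Delta>min \<Delta>neq (2 / (1 - c)\<^sup>2)"
    using \<Delta> i1_i2 in_gap_kappa_class[of \<gamma> i1 \<Delta>min \<Delta>neq] by (auto simp: \<gamma>_def)
  define I where "I = UNIV - {i1, i2}"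
  have card_I: "real (card I) = real CARD('n) - 2"
    using i1_i2 card_mono[of UNIV "{i1, i2}"] by (simp add: I_def card_Diff_subset)
  have pulls_ge: "ln (real T) / (3 * \<Delta>min\<^sup>2) \<le> pulls (\<gamma>, 0) T (axis k 1)" if k: "k \<in> I" for k
  proof -
    have k_neq: "k \<noteq> i1" "k \<noteq> i2"
      using k by (auto simp: I_def)
    have \<gamma>'_best: "separated_best X (\<gamma>' k) (axis k 1) \<Delta>min"
      and \<gamma>'_class: "(\<gamma>' k, 0) \<in> gap_kappa_class X z \<Delta>min \<Delta>neq (2 / (1 - c)\<^sup>2)"
      using \<Delta> k_neq i1_i2 in_gap_kappa_class[of "\<gamma>' k" k \<Delta>min \<Delta>neq] by (auto simp: \<gamma>'_def \<gamma>_def)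
    have squared_gap: "squared_mean_gap (\<gamma>, 0) (\<gamma>' k, 0) (axis i 1) = (if i = k then (2 * \<Delta>min)\<^sup>2 else 0)"
      "squared_mean_gap (\<gamma>, 0) (\<gamma>' k, 0) probe = 0" for i
      using k_neq by (auto simp: squared_mean_gap_def mean_reward_def \<gamma>'_def \<gamma>_def)
    have "2/3 * ln (real T) \<le> (\<Sum>x\<in>X. squared_mean_gap (\<gamma>, 0) (\<gamma>' k, 0) x * pulls (\<gamma>, 0) T x) / 2"
      using \<gamma>_best \<gamma>'_best k_neq \<Delta> T regret[OF \<gamma>_class] regret[OF \<gamma>'_class] horizon
      by (intro small_regret_forces_exploration[where B=B and D=\<Delta>min and a="axis i1 1" and a'="axis k 1"])
        (auto simp: axis_eq_axis)
    also have "\<dots> = 2 * \<Delta>min\<^sup>2 * pulls (\<gamma>, 0) T (axis k 1)"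
      by (simp add: sum_X squared_gap if_distrib[where f="\<lambda>r. r * _"] power2_eq_square cong: if_cong)
    finally show ?thesis
      using \<Delta> by (simp add: field_simps)
  qed
  have "(real CARD('n) - 2) / (3 * \<Delta>min) * ln (real T) = (\<Sum>k\<in>I. \<Delta>min * (ln (real T) / (3 * \<Delta>min\<^sup>2)))"
    using \<Delta> by (simp add: card_I power2_eq_square)
  also have "\<dots> \<le> (\<Sum>k\<in>I. \<Delta>min * pulls (\<gamma>, 0) T (axis k 1))"
    using pulls_ge \<Delta> by (intro sum_mono mult_left_mono) auto
  also have "\<dots> = (\<Sum>x\<in>(\<lambda>k. axis k 1) ` I. ((axis i1 1 - x) \<bullet> fst (\<gamma>, 0 :: real)) * pulls (\<gamma>, 0) T x)"
    by (subst sum.reindex) (auto simp: inj_on_def axis_eq_axis inner_diff_left I_def \<gamma>_def)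
  also have "\<dots> \<le> regret X z Q \<phi> (\<gamma>, 0) T"
    using \<gamma>_best \<Delta> by (intro sum_gap_pulls_le_regret[where D=\<Delta>min]) auto
  finally show ?thesis
    using \<gamma>_class by blast
qed

text \<open>
  The first parameter has bias 0 and the second has bias \<open>\<Delta>neq\<close>, which compensates the shift of all basis
  vectors: down by \<open>\<Delta>neq\<close> in group 1, and up by \<open>\<Delta>neq\<close> for \<open>e\<^sub>2\<close>. On the probe the shift \<open>c \<Delta>neq\<close> of the
  value and the shift \<open>- \<Delta>neq\<close> of the bias do not cancel.
\<close>

lemma bias_estimation_lower_bound:
  fixes B :: real and Q :: "real measure" and \<phi> :: "nat \<Rightarrow> real \<Rightarrow> 'n history \<Rightarrow> real ^ 'n"
  assumes algorithm: "bandit_algorithm X Q \<phi>"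
    and \<Delta>: "0 < \<Delta>min" "\<Delta>min \<le> \<Delta>neq" "\<Delta>neq < 1/8" and T: "0 < T"
    and regret: "\<And>\<theta>. \<theta> \<in> gap_kappa_class X z \<Delta>min \<Delta>neq (2 / (1 - c)\<^sup>2) \<Longrightarrow>
      regret X z Q \<phi> \<theta> T \<le> B * ln (real T)"
    and horizon: "long_horizon (B / \<Delta>min) T"
  shows "\<exists>\<theta>\<in>gap_kappa_class X z \<Delta>min \<Delta>neq (2 / (1 - c)\<^sup>2).
    1 / (2 * (1 - c)\<^sup>2 * \<Delta>neq\<^sup>2) * ln (real T) \<le> regret X z Q \<phi> \<theta> T"
proof -
  interpret bandit X z Q \<phi>
    using finite_actions algorithm by unfold_locales
  define \<gamma> :: "real ^ 'n" where
    "\<gamma> = (\<chi> i. if i = i1 then 3/8 else 3/8 - \<Delta>neq)"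
  define \<gamma>' :: "real ^ 'n" where
    "\<gamma>' = (\<chi> i. if i = i2 then 3/8 else \<gamma> $ i - \<Delta>neq)"
  have \<gamma>_best: "separated_best X \<gamma> (axis i1 1) \<Delta>min"
    and \<gamma>_class: "(\<gamma>, 0) \<in> gap_kappa_class X z \<Delta>min \<Delta>neq (2 / (1 - c)\<^sup>2)"
    using \<Delta> i1_i2 in_gap_kappa_class[of \<gamma> i1 \<Delta>min \<Delta>neq] by (auto simp: \<gamma>_def)
  have \<gamma>'_best: "separated_best X \<gamma>' (axis i2 1) \<Delta>min"
    and \<gamma>'_class: "(\<gamma>', \<Delta>neq) \<in> gap_kappa_class X z \<Delta>min \<Delta>neq (2 / (1 - c)\<^sup>2)"
    using \<Delta> i1_i2 in_gap_kappa_class[of \<gamma>' i2 \<Delta>min \<Delta>neq] by (auto simp: \<gamma>'_def \<gamma>_def)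
  have squared_gap: "squared_mean_gap (\<gamma>, 0) (\<gamma>', \<Delta>neq) (axis i 1) = 0"
    "squared_mean_gap (\<gamma>, 0) (\<gamma>', \<Delta>neq) probe = ((1 - c) * \<Delta>neq)\<^sup>2" for i
    using i1_i2 by (auto simp: squared_mean_gap_def mean_reward_def \<gamma>'_def \<gamma>_def power2_eq_square field_simps)
  have "2/3 * ln (real T) \<le> (\<Sum>x\<in>X. squared_mean_gap (\<gamma>, 0) (\<gamma>', \<Delta>neq) x * pulls (\<gamma>, 0) T x) / 2"
    using \<gamma>_best \<gamma>'_best i1_i2 \<Delta> T regret[OF \<gamma>_class] regret[OF \<gamma>'_class] horizon
    by (intro small_regret_forces_exploration[where B=B and D=\<Delta>min and a="axis i1 1" and a'="axis i2 1"])
      (auto simp: axis_eq_axis)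
  also have "\<dots> = ((1 - c) * \<Delta>neq)\<^sup>2 / 2 * pulls (\<gamma>, 0) T probe"
    by (simp add: sum_X squared_gap)
  finally have pulls_ge: "4/3 * ln (real T) \<le> ((1 - c) * \<Delta>neq)\<^sup>2 * pulls (\<gamma>, 0) T probe"
    by simp
  have "0 < ((1 - c) * \<Delta>neq)\<^sup>2"
    using c \<Delta> by simp
  with pulls_ge have "4/3 * ln (real T) / ((1 - c) * \<Delta>neq)\<^sup>2 \<le> pulls (\<gamma>, 0) T probe"
    by (simp add: divide_le_eq mult.commute)
  then have "3/8 * (4/3 * ln (real T) / ((1 - c) * \<Delta>neq)\<^sup>2) \<le> 3/8 * pulls (\<gamma>, 0) T probe"
    by simp
  also have "\<dots> \<le> (axis i1 1 - probe) \<bullet> \<gamma> * pulls (\<gamma>, 0) T probe"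
    using c pulls_nonneg by (intro mult_right_mono) (auto simp: inner_diff_left \<gamma>_def)
  also have "\<dots> = (\<Sum>x\<in>{probe}. ((axis i1 1 - x) \<bullet> fst (\<gamma>, 0 :: real)) * pulls (\<gamma>, 0) T x)"
    by simp
  also have "\<dots> \<le> regret X z Q \<phi> (\<gamma>, 0) T"
    using \<gamma>_best \<Delta> by (intro sum_gap_pulls_le_regret[where D=\<Delta>min]) auto
  finally show ?thesis
    using \<gamma>_class by (auto simp: power_mult_distrib mult_ac)
qed

end

theorem theorem4:
  fixes \<kappa> :: real
  assumes "\<kappa> \<ge> 2" and "CARD('n::finite) \<ge> 4"
  shows "\<exists>(X :: (real ^ 'n) set) z. action_set X z \<and>
    (\<forall>(Q :: nat \<Rightarrow> real measure) (\<phi> :: nat \<Rightarrow> nat \<Rightarrow> real \<Rightarrow> 'n history \<Rightarrow> real ^ 'n).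
      (\<forall>T. bandit_algorithm X (Q T) (\<phi> T)) \<longrightarrow>
      (\<forall>\<Delta>min \<Delta>neq :: real.
        \<Delta>min \<in> {0<..<1/8} \<and> \<Delta>neq \<in> {0<..<1/8} \<and> \<Delta>min \<le> \<Delta>neq \<longrightarrow>
        liminf (\<lambda>T. SUP \<theta>\<in>gap_kappa_class X z \<Delta>min \<Delta>neq \<kappa>.
                  ereal (regret X z (Q T) (\<phi> T) \<theta> T / ln (real T)))
        \<ge> ereal (max (real CARD('n) / (10 * \<Delta>min)) ((\<kappa> + 2) / (8 * \<Delta>neq\<^sup>2)))))"
proof -
  obtain i1 i2 :: 'n where i1_i2: "i1 \<noteq> i2"
    using assms(2) card_le_Suc0_iff_eq[of "UNIV :: 'n set"] by fastforce
  define c where "c = 1 - sqrt (2 / \<kappa>)"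
  have \<kappa>: "2 / (1 - c)\<^sup>2 = \<kappa>"
    using assms(1) by (simp add: c_def)
  interpret hard_instance c i1 i2
    using assms(1) i1_i2 by unfold_locales (auto simp: c_def)
  show ?thesis
  proof (intro exI conjI allI impI)
    show "action_set X z"
      by (rule action_set)
    fix Q :: "nat \<Rightarrow> real measure" and \<phi> :: "nat \<Rightarrow> nat \<Rightarrow> real \<Rightarrow> 'n history \<Rightarrow> real ^ 'n"
      and \<Delta>min \<Delta>neq :: real
    assume algorithm: "\<forall>T. bandit_algorithm X (Q T) (\<phi> T)"
      and "\<Delta>min \<in> {0<..<1/8} \<and> \<Delta>neq \<in> {0<..<1/8} \<and> \<Delta>min \<le> \<Delta>neq"
    then have \<Delta>: "0 < \<Delta>min" "\<Delta>min \<le> \<Delta>neq" "\<Delta>neq < 1/8"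
      by auto
    define B where "B = max (real CARD('n) / (10 * \<Delta>min)) ((\<kappa> + 2) / (8 * \<Delta>neq\<^sup>2))"
    let ?class = "gap_kappa_class X z \<Delta>min \<Delta>neq \<kappa>"
    let ?ratio = "\<lambda>T \<theta>. regret X z (Q T) (\<phi> T) \<theta> T / ln (real T)"
    \<comment> \<open>here \<open>d \<ge> 4\<close> gives \<open>d / 10 \<le> (d - 2) / 3\<close>, and \<open>\<kappa> \<ge> 2\<close> gives \<open>\<kappa> + 2 \<le> 2 \<kappa>\<close>\<close>
    have B_cases: "B \<le> (real CARD('n) - 2) / (3 * \<Delta>min) \<or> B \<le> 1 / (2 * (1 - c)\<^sup>2 * \<Delta>neq\<^sup>2)"
    proof -
      have "real CARD('n) / (10 * \<Delta>min) \<le> (real CARD('n) - 2) / (3 * \<Delta>min)"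
        using assms(2) \<Delta> by (simp add: field_simps)
      moreover have "(\<kappa> + 2) / (8 * \<Delta>neq\<^sup>2) \<le> (2 / (1 - c)\<^sup>2) / (4 * \<Delta>neq\<^sup>2)"
        unfolding \<kappa> using assms(1) \<Delta> by (simp add: field_simps)
      ultimately show ?thesis
        by (auto simp: B_def max_def mult_ac)
    qed
    have "0 < real CARD('n) / (10 * \<Delta>min)"
      using assms(2) \<Delta> by simp
    then have "0 < B"
      by (simp add: B_def less_max_iff_disj)
    then have "0 < B / \<Delta>min"
      using \<Delta> by simp
    from eventually_long_horizon[OF this] eventually_gt_at_top[of 1]
    have "\<forall>\<^sub>F T in sequentially. ereal B \<le> (SUP \<theta>\<in>?class. ereal (?ratio T \<theta>))"
    proof eventually_elim
      case (elim T)
      show ?case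
      proof (rule ccontr)
        assume "\<not> ?case"
        then have sup: "(SUP \<theta>\<in>?class. ereal (?ratio T \<theta>)) < ereal B"
          by (simp add: not_le)
        have "ereal (?ratio T \<theta>) < ereal B" if "\<theta> \<in> ?class" for \<theta>
          using SUP_upper[OF that] sup by (rule le_less_trans)
        then have regret: "regret X z (Q T) (\<phi> T) \<theta> T < B * ln (real T)" if "\<theta> \<in> ?class" for \<theta>
          using elim that by (simp add: divide_less_eq)
        have T: "0 < T"
          using elim by simp
        have "\<exists>\<theta>\<in>?class. B * ln (real T) \<le> regret X z (Q T) (\<phi> T) \<theta> T"
          using B_cases
        proof
          assume "B \<le> (real CARD('n) - 2) / (3 * \<Delta>min)"
          from mult_right_mono[OF this, of "ln (real T)"] show ?thesis
            using same_group_lower_bound[OF algorithm[rule_format] \<Delta> T, of T B, unfolded \<kappa>] regret elim T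
            by (fastforce intro: less_imp_le)
        next
          assume "B \<le> 1 / (2 * (1 - c)\<^sup>2 * \<Delta>neq\<^sup>2)"
          from mult_right_mono[OF this, of "ln (real T)"] show ?thesis
            using bias_estimation_lower_bound[OF algorithm[rule_format] \<Delta> T, of T B, unfolded \<kappa>] regret elim T
            by (fastforce intro: less_imp_le)
        qed
        then show False
          using regret by force
      qed
    qed
    then show "ereal B \<le> liminf (\<lambda>T. SUP \<theta>\<in>?class. ereal (?ratio T \<theta>))"
      by (rule Liminf_bounded)
  qed
qed
end
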